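(* Let $\kappa$ be a cardinal and let $J(\kappa)$ be the hedgehog space of spininess $\kappa$ in which each spine is a sequence converging to the center point. Then $F_4\bigl(J(\kappa)\bigr)$ is Fréchet-Urysohn.
   Context: $J(\kappa)$ is the metrizable hedgehog whose spines are convergent sequences: its underlying set is $\{0\}\cup(\kappa\times\mathbb N)$, where $\mathbb N=\{1,2,\ldots\}$; every point $(\alpha,n)\in\kappa\times\mathbb N$ is isolated, and the center point $0$ has the neighborhood base consisting of the sets $\{0\}\cup\{(\alpha,n):\alpha\in\kappa,\ n\ge m\}$, $m\in\mathbb N$. For a Tychonoff space $X$, $F(X)$ denotes the (Markov) free topological group on $X$: as an abstract group it is the free group on the set $X$, it carries a group topology inducing the original topology on $X\subseteq F(X)$, and every continuous map from $X$ to an arbitrary topological group extends uniquely to a continuous homomorphism from $F(X)$. $F_4(X)$ is the subset of $F(X)$ consisting of all words of reduced length at most $4$ (with respect to the free basis $X$), equipped with the subspace topology. A topological space $Y$ is Fréchet-Urysohn if for every $A\subseteq Y$ and every $y\in\overline{A}$ there is a sequence of points of $A$ converging to $y$. *)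

theory Defs
  imports "HOL-Analysis.Analysis" "HOL-Algebra.Group"
begin

section \<open>The abstract free group\<close>

text \<open>A letter \<open>(x, True)\<close> stands for the generator \<open>x\<close> and \<open>(x, False)\<close> for its formal inverse.
  Elements of the free group are the reduced words, so list length is reduced length.\<close>

type_synonym 'a letter = "'a \<times> bool"
type_synonym 'a word = "'a letter list"

definition inv_letter :: "'a letter \<Rightarrow> 'a letter" where
  "inv_letter a = (fst a, \<not> snd a)"

definition reduced_word :: "'a word \<Rightarrow> bool" where
  "reduced_word w \<longleftrightarrow> successively (\<lambda>a b. b \<noteq> inv_letter a) w"

definition cancel_Cons :: "'a letter \<Rightarrow> 'a word \<Rightarrow> 'a word" where
  "cancel_Cons a w =
     (case w of [] \<Rightarrow> [a] | b # u \<Rightarrow> if b = inv_letter a then u else a # w)"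

text \<open>The product of reduced words \<open>u\<close> and \<open>v\<close> is the reduced form of \<open>u @ v\<close>, obtained by
  prepending the letters of \<open>u\<close> to \<open>v\<close> one by one, cancelling where possible.\<close>

definition free_group :: "'a set \<Rightarrow> 'a word monoid" where
  "free_group S = \<lparr>carrier = {w. reduced_word w \<and> fst ` set w \<subseteq> S},
                   mult = (\<lambda>u v. foldr cancel_Cons u v),
                   one = []\<rparr>"

definition free_gen :: "'a \<Rightarrow> 'a word" where
  "free_gen x = [(x, True)]"

definition free_group_le :: "'a set \<Rightarrow> nat \<Rightarrow> 'a word set" where
  "free_group_le S n = {w \<in> carrier (free_group S). length w \<le> n}"


section \<open>Topological groups and free topological groups\<close>

definition topological_group :: "('g, 'b) monoid_scheme \<Rightarrow> 'g topology \<Rightarrow> bool" where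
  "topological_group G T \<longleftrightarrow>
     group G \<and> topspace T = carrier G \<and>
     continuous_map (prod_topology T T) T (\<lambda>(x, y). x \<otimes>\<^bsub>G\<^esub> y) \<and>
     continuous_map T T (\<lambda>x. inv\<^bsub>G\<^esub> x)"

text \<open>\<open>free_topological_group X T\<close>: the free group on the points of \<open>X\<close>, topologized by \<open>T\<close>, is the
  (Markov) free topological group on \<open>X\<close>. HOL does not allow a definition to quantify over types,
  so the test groups \<open>H\<close> live on the type of words over \<open>X\<close>. This is no restriction: the universal
  property for groups on an arbitrary type is lemma \<open>free_topological_group_universal\<close> below.
  Homomorphisms are taken extensional since only their values on the carrier matter.\<close>

definition free_topological_group :: "'a topology \<Rightarrow> 'a word topology \<Rightarrow> bool" where
  "free_topological_group X T \<longleftrightarrow>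
     topological_group (free_group (topspace X)) T \<and>
     embedding_map X T free_gen \<and>
     (\<forall>(H :: 'a word monoid) TH f.
        topological_group H TH \<and> continuous_map X TH f \<longrightarrow>
        (\<exists>!\<phi>. \<phi> \<in> extensional (carrier (free_group (topspace X))) \<and>
              \<phi> \<in> hom (free_group (topspace X)) H \<and> continuous_map T TH \<phi> \<and>
              (\<forall>x\<in>topspace X. \<phi> (free_gen x) = f x)))"


section \<open>The Frechet-Urysohn property\<close>

definition frechet_urysohn_space :: "'a topology \<Rightarrow> bool" where
  "frechet_urysohn_space Y \<longleftrightarrow>
     (\<forall>A y. A \<subseteq> topspace Y \<and> y \<in> Y closure_of A \<longrightarrow>
        (\<exists>s :: nat \<Rightarrow> 'a. range s \<subseteq> A \<and> limitin Y s y sequentially))"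


section \<open>The hedgehog whose spines are convergent sequences\<close>

datatype 'k hedgehog_point = Center | Spine 'k nat

text \<open>The cardinal \<open>\<kappa>\<close> is represented by an arbitrary set \<open>K\<close> of that cardinality.\<close>

definition hedgehog_points :: "'k set \<Rightarrow> 'k hedgehog_point set" where
  "hedgehog_points K = insert Center {Spine \<alpha> n |\<alpha> n. \<alpha> \<in> K \<and> 1 \<le> n}"

definition hedgehog :: "'k set \<Rightarrow> 'k hedgehog_point topology" where
  "hedgehog K = topology (\<lambda>U. U \<subseteq> hedgehog_points K \<and>
     (Center \<in> U \<longrightarrow>
       (\<exists>m\<ge>1. insert Center {Spine \<alpha> n |\<alpha> n. \<alpha> \<in> K \<and> m \<le> n} \<subseteq> U)))"

lemma openin_hedgehog:
  "openin (hedgehog K) U \<longleftrightarrow> U \<subseteq> hedgehog_points K \<and>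
     (Center \<in> U \<longrightarrow>
       (\<exists>m\<ge>1. insert Center {Spine \<alpha> n |\<alpha> n. \<alpha> \<in> K \<and> m \<le> n} \<subseteq> U))"
proof -
  let ?B = "\<lambda>m. insert Center {Spine \<alpha> n |\<alpha> n. \<alpha> \<in> K \<and> m \<le> n}"
  have anti: "?B m \<subseteq> ?B m'" if "m' \<le> m" for m m' :: nat
    using that by (auto intro: order_trans)
  have "istopology (\<lambda>U. U \<subseteq> hedgehog_points K \<and> (Center \<in> U \<longrightarrow> (\<exists>m\<ge>1. ?B m \<subseteq> U)))"
    unfolding istopology_def
  proof (rule conjI; intro allI impI)
    fix S T
    assume S: "S \<subseteq> hedgehog_points K \<and> (Center \<in> S \<longrightarrow> (\<exists>m\<ge>1. ?B m \<subseteq> S))"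
      and T: "T \<subseteq> hedgehog_points K \<and> (Center \<in> T \<longrightarrow> (\<exists>m\<ge>1. ?B m \<subseteq> T))"
    show "S \<inter> T \<subseteq> hedgehog_points K \<and> (Center \<in> S \<inter> T \<longrightarrow> (\<exists>m\<ge>1. ?B m \<subseteq> S \<inter> T))"
    proof (intro conjI impI)
      show "S \<inter> T \<subseteq> hedgehog_points K" using S by blast
      assume "Center \<in> S \<inter> T"
      then obtain m1 m2 where m: "1 \<le> m1" "?B m1 \<subseteq> S" "1 \<le> m2" "?B m2 \<subseteq> T"
        using S T by blast
      have "?B (max m1 m2) \<subseteq> S \<inter> T"
        using order_trans[OF anti m(2), of "max m1 m2"] order_trans[OF anti m(4), of "max m1 m2"]
        by (intro Int_greatest) simp_all
      then show "\<exists>m\<ge>1. ?B m \<subseteq> S \<inter> T" using m(1) by (meson max.coboundedI1)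
    qed
  next
    fix \<K>
    assume *: "\<forall>U\<in>\<K>. U \<subseteq> hedgehog_points K \<and> (Center \<in> U \<longrightarrow> (\<exists>m\<ge>1. ?B m \<subseteq> U))"
    show "\<Union>\<K> \<subseteq> hedgehog_points K \<and> (Center \<in> \<Union>\<K> \<longrightarrow> (\<exists>m\<ge>1. ?B m \<subseteq> \<Union>\<K>))"
    proof (intro conjI impI)
      show "\<Union>\<K> \<subseteq> hedgehog_points K" using * by blast
      assume "Center \<in> \<Union>\<K>"
      then obtain U where U: "U \<in> \<K>" "Center \<in> U" by blast
      then obtain m where "m \<ge> 1" "?B m \<subseteq> U" using * by blast
      then show "\<exists>m\<ge>1. ?B m \<subseteq> \<Union>\<K>" using U(1) by (meson Union_upper order_trans)
    qed
  qed
  then show ?thesis by (simp add: hedgehog_def topology_inverse')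
qed

lemma topspace_hedgehog [simp]: "topspace (hedgehog K) = hedgehog_points K"
proof -
  have "openin (hedgehog K) (hedgehog_points K)"
    by (auto simp: openin_hedgehog hedgehog_points_def intro!: exI[of _ 1])
  then show ?thesis
    by (meson openin_hedgehog openin_subset openin_topspace subset_antisym)
qed


section \<open>Basic facts on free groups\<close>

lemma inv_letter_simps [simp]:
  "inv_letter (inv_letter a) = a" "fst (inv_letter a) = fst a"
  "inv_letter a \<noteq> a" "a \<noteq> inv_letter a"
  by (auto simp: inv_letter_def prod_eq_iff)

lemma inv_letter_pair [simp]: "inv_letter (x, s) = (x, \<not> s)"
  by (simp add: inv_letter_def)

lemma carrier_free_group: "w \<in> carrier (free_group S) \<longleftrightarrow> reduced_word w \<and> fst ` set w \<subseteq> S"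
  and mult_free_group: "u \<otimes>\<^bsub>free_group S\<^esub> v = foldr cancel_Cons u v"
  and one_free_group: "\<one>\<^bsub>free_group S\<^esub> = []"
  by (simp_all add: free_group_def)

lemma reduced_simps [simp]: "reduced_word []" "reduced_word [a]"
  "reduced_word (a # b # w) \<longleftrightarrow> b \<noteq> inv_letter a \<and> reduced_word (b # w)"
  by (auto simp: reduced_word_def)

lemma reduced_ConsD: "reduced_word (a # w) \<Longrightarrow> reduced_word w"
  by (cases w) auto

lemma reduced_cancel_Cons: "reduced_word w \<Longrightarrow> reduced_word (cancel_Cons a w)"
  by (cases w) (auto simp: cancel_Cons_def dest: reduced_ConsD)

lemma set_cancel_Cons: "fst ` set (cancel_Cons a w) \<subseteq> insert (fst a) (fst ` set w)"
  by (cases w) (auto simp: cancel_Cons_def)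

lemma cancel_Cons_reduced: "reduced_word (a # w) \<Longrightarrow> cancel_Cons a w = a # w"
  by (cases w) (auto simp: cancel_Cons_def)

lemma cancel_Cons_inv: "reduced_word w \<Longrightarrow> cancel_Cons a (cancel_Cons (inv_letter a) w) = w"
  by (cases w) (auto simp: cancel_Cons_def cancel_Cons_reduced[unfolded cancel_Cons_def])

lemma cancel_Cons_inv': "reduced_word w \<Longrightarrow> cancel_Cons (inv_letter a) (cancel_Cons a w) = w"
  using cancel_Cons_inv[of w "inv_letter a"] by simp

lemma reduced_foldr_cancel_Cons: "reduced_word v \<Longrightarrow> reduced_word (foldr cancel_Cons u v)"
  by (induction u) (auto simp: reduced_cancel_Cons)

lemma set_foldr_cancel_Cons:
  "fst ` set (foldr cancel_Cons u v) \<subseteq> fst ` set u \<union> fst ` set v"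
proof (induction u)
  case (Cons a u)
  have "fst ` set (cancel_Cons a (foldr cancel_Cons u v)) \<subseteq>
      insert (fst a) (fst ` set (foldr cancel_Cons u v))"
    by (rule set_cancel_Cons)
  also have "\<dots> \<subseteq> insert (fst a) (fst ` set u \<union> fst ` set v)"
    using Cons by (rule insert_mono)
  finally show ?case by simp
qed simp

lemma foldr_cancel_Cons_Nil: "reduced_word w \<Longrightarrow> foldr cancel_Cons w [] = w"
proof (induction w)
  case (Cons a w)
  then have "foldr cancel_Cons w [] = w" using reduced_ConsD by blast
  then show ?case using Cons.prems by (simp add: cancel_Cons_reduced)
qed simp

lemma foldr_cancel_Cons_cancel_Cons:
  assumes "reduced_word w"
  shows "foldr cancel_Cons (cancel_Cons a u) w = cancel_Cons a (foldr cancel_Cons u w)"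
proof (cases u)
  case (Cons b v)
  then show ?thesis
    using cancel_Cons_inv[OF reduced_foldr_cancel_Cons[OF assms, of v], of a]
    by (simp add: cancel_Cons_def[of a "b # v"])
qed (simp add: cancel_Cons_def)

lemma foldr_cancel_Cons_assoc:
  "reduced_word w \<Longrightarrow>
     foldr cancel_Cons (foldr cancel_Cons u v) w = foldr cancel_Cons u (foldr cancel_Cons v w)"
  by (induction u) (simp_all add: foldr_cancel_Cons_cancel_Cons)

lemma foldr_cancel_Cons_inverse:
  "reduced_word v \<Longrightarrow> foldr cancel_Cons (map inv_letter (rev w)) (foldr cancel_Cons w v) = v"
  by (induction w arbitrary: v) (simp_all add: cancel_Cons_inv' reduced_foldr_cancel_Cons)

lemma group_free_group: "group (free_group S)"
proof (rule groupI)
  fix w assume w: "w \<in> carrier (free_group S)"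
  let ?v = "foldr cancel_Cons (map inv_letter (rev w)) []"
  have "?v \<in> carrier (free_group S)"
    using w set_foldr_cancel_Cons[of "map inv_letter (rev w)" "[]"]
    by (auto simp: carrier_free_group reduced_foldr_cancel_Cons image_image)
  moreover have "foldr cancel_Cons ?v w = []"
    using w foldr_cancel_Cons_inverse[of "[]" w]
    by (simp add: carrier_free_group foldr_cancel_Cons_assoc foldr_cancel_Cons_Nil)
  ultimately show "\<exists>y\<in>carrier (free_group S). y \<otimes>\<^bsub>free_group S\<^esub> w = \<one>\<^bsub>free_group S\<^esub>"
    by (auto simp: mult_free_group one_free_group)
next
  fix u v assume "u \<in> carrier (free_group S)" "v \<in> carrier (free_group S)"
  then show "u \<otimes>\<^bsub>free_group S\<^esub> v \<in> carrier (free_group S)"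
    using order_trans[OF set_foldr_cancel_Cons[of u v], of S]
    by (simp add: carrier_free_group mult_free_group reduced_foldr_cancel_Cons)
qed (auto simp: carrier_free_group mult_free_group one_free_group foldr_cancel_Cons_assoc)

lemma free_gen_carrier: "x \<in> S \<Longrightarrow> free_gen x \<in> carrier (free_group S)"
  by (simp add: free_gen_def carrier_free_group)

lemma inv_free_gen:
  assumes "x \<in> S"
  shows "inv\<^bsub>free_group S\<^esub> (free_gen x) = [(x, False)]"
  by (rule group.inv_equality[OF group_free_group])
    (use assms in \<open>auto simp: free_gen_def carrier_free_group mult_free_group one_free_group
       cancel_Cons_def\<close>)

definition free_lift :: "('g, 'b) monoid_scheme \<Rightarrow> ('a \<Rightarrow> 'g) \<Rightarrow> 'a word \<Rightarrow> 'g" where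
  "free_lift H f w =
     foldr (\<lambda>a h. (if snd a then f (fst a) else inv\<^bsub>H\<^esub> (f (fst a))) \<otimes>\<^bsub>H\<^esub> h) w \<one>\<^bsub>H\<^esub>"

context
  fixes H :: "('g, 'b) monoid_scheme" and S :: "'a set" and f :: "'a \<Rightarrow> 'g"
  assumes H: "group H" and f: "f \<in> S \<rightarrow> carrier H"
begin

interpretation H: group H by (rule H)

lemma free_lift_closed: "fst ` set w \<subseteq> S \<Longrightarrow> free_lift H f w \<in> carrier H"
  using f by (induction w) (auto simp: free_lift_def Pi_iff)

lemma free_lift_Cons:
  "free_lift H f (a # w) =
     (if snd a then f (fst a) else inv\<^bsub>H\<^esub> (f (fst a))) \<otimes>\<^bsub>H\<^esub> free_lift H f w"
  by (simp add: free_lift_def)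

lemma free_lift_cancel_Cons:
  assumes "fst ` set (a # w) \<subseteq> S"
  shows "free_lift H f (cancel_Cons a w) = free_lift H f (a # w)"
proof (cases w)
  case (Cons b u)
  have "f (fst a) \<in> carrier H" "free_lift H f u \<in> carrier H"
    using assms f Cons by (auto intro: free_lift_closed)
  then show ?thesis
    using Cons by (cases a) (auto simp: cancel_Cons_def free_lift_Cons simp flip: H.m_assoc)
qed (simp add: cancel_Cons_def)

lemma free_lift_hom: "free_lift H f \<in> hom (free_group S) H"
proof (rule homI)
  have "free_lift H f (foldr cancel_Cons u v) = free_lift H f u \<otimes>\<^bsub>H\<^esub> free_lift H f v"
    if "fst ` set u \<subseteq> S" "fst ` set v \<subseteq> S" for u v
    using that
  proof (induction u)
    case Nil
    then show ?case using free_lift_closed[of v] by (simp add: free_lift_def)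
  next
    case (Cons a u)
    have "fst ` set (a # foldr cancel_Cons u v) \<subseteq> S"
      using Cons.prems order_trans[OF set_foldr_cancel_Cons[of u v], of S] by simp
    moreover have "f (fst a) \<in> carrier H" "free_lift H f u \<in> carrier H"
      "free_lift H f v \<in> carrier H"
      using Cons.prems f by (auto intro: free_lift_closed)
    ultimately show ?case
      using Cons by (simp add: free_lift_cancel_Cons free_lift_Cons H.m_assoc)
  qed
  then show "free_lift H f (u \<otimes>\<^bsub>free_group S\<^esub> v) = free_lift H f u \<otimes>\<^bsub>H\<^esub> free_lift H f v"
    if "u \<in> carrier (free_group S)" "v \<in> carrier (free_group S)" for u v
    using that by (simp add: carrier_free_group mult_free_group)
qed (simp add: carrier_free_group free_lift_closed)

lemma free_lift_gen: "x \<in> S \<Longrightarrow> free_lift H f (free_gen x) = f x"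
  using H.r_one[OF funcset_mem[OF f]] by (simp add: free_lift_def free_gen_def)

lemma hom_free_group_unique:
  assumes \<phi>: "\<phi> \<in> hom (free_group S) H" "\<And>x. x \<in> S \<Longrightarrow> \<phi> (free_gen x) = f x"
    and w: "w \<in> carrier (free_group S)"
  shows "\<phi> w = free_lift H f w"
proof -
  interpret \<phi>: group_hom "free_group S" H \<phi>
    using \<phi>(1) H group_free_group by (simp add: group_hom_def group_hom_axioms_def)
  show ?thesis using w
  proof (induction w)
    case Nil
    then show ?case using \<phi>.hom_one by (simp add: one_free_group free_lift_def)
  next
    case (Cons a w)
    obtain x s where a: "a = (x, s)" by (cases a)
    have w: "w \<in> carrier (free_group S)" and x: "x \<in> S"
      and a': "[a] \<in> carrier (free_group S)"
      using Cons.prems a by (auto simp: carrier_free_group dest: reduced_ConsD)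
    have "a # w = [a] \<otimes>\<^bsub>free_group S\<^esub> w"
      using Cons.prems by (simp add: mult_free_group carrier_free_group cancel_Cons_reduced)
    moreover have "\<phi> [a] = (if s then f x else inv\<^bsub>H\<^esub> (f x))"
      using \<phi>(2)[OF x] \<phi>.hom_inv[OF free_gen_carrier[OF x]] inv_free_gen[OF x] a
      by (auto simp: free_gen_def)
    ultimately show ?case
      using Cons.IH[OF w] \<phi>.hom_mult[OF a' w] a free_lift_Cons[of a w] by simp
  qed
qed

end


section \<open>Adequacy of the definition of free topological groups\<close>

lemma topological_group_pullback:
  assumes G: "group G" and H: "topological_group H TH" and \<phi>: "\<phi> \<in> hom G H"
  shows "topological_group G (pullback_topology (carrier G) \<phi> TH)"
proof -
  let ?T = "pullback_topology (carrier G) \<phi> TH"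
  interpret \<phi>: group_hom G H \<phi>
    using assms by (simp add: group_hom_def group_hom_axioms_def topological_group_def)
  have TH: "topspace TH = carrier H"
    and mult: "continuous_map (prod_topology TH TH) TH (\<lambda>(x, y). x \<otimes>\<^bsub>H\<^esub> y)"
    and inv: "continuous_map TH TH (\<lambda>x. inv\<^bsub>H\<^esub> x)"
    using H by (auto simp: topological_group_def)
  have top: "topspace ?T = carrier G"
    using TH by (auto simp: topspace_pullback_topology)
  have \<phi>c: "continuous_map ?T TH \<phi>"
    using continuous_map_pullback[OF continuous_map_id, of "carrier G" \<phi> TH] by simp
  have "continuous_map (prod_topology ?T ?T) TH (\<lambda>p. \<phi> (fst p) \<otimes>\<^bsub>H\<^esub> \<phi> (snd p))"
    using continuous_map_compose[OF _ mult, of "prod_topology ?T ?T" "\<lambda>p. (\<phi> (fst p), \<phi> (snd p))"]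
      continuous_map_compose[OF continuous_map_fst \<phi>c, of ?T]
      continuous_map_compose[OF continuous_map_snd \<phi>c, of ?T]
    by (simp add: continuous_map_pairedI o_def)
  then have "continuous_map (prod_topology ?T ?T) TH (\<phi> \<circ> (\<lambda>(x, y). x \<otimes>\<^bsub>G\<^esub> y))"
    by (rule continuous_map_eq) (auto simp: top)
  then have "continuous_map (prod_topology ?T ?T) ?T (\<lambda>(x, y). x \<otimes>\<^bsub>G\<^esub> y)"
    by (rule continuous_map_pullback') (auto simp: top)
  moreover have "continuous_map ?T TH (\<phi> \<circ> (\<lambda>x. inv\<^bsub>G\<^esub> x))"
    by (rule continuous_map_eq[OF continuous_map_compose[OF \<phi>c inv]]) (auto simp: top)
  then have "continuous_map ?T ?T (\<lambda>x. inv\<^bsub>G\<^esub> x)"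
    by (rule continuous_map_pullback') (auto simp: top)
  ultimately show ?thesis using G top by (simp add: topological_group_def)
qed

lemma free_topological_group_finest:
  assumes T: "free_topological_group X T"
    and T': "topological_group (free_group (topspace X)) T'" "continuous_map X T' free_gen"
    and U: "openin T' U"
  shows "openin T U"
proof -
  let ?F = "free_group (topspace X)"
  obtain \<phi> where \<phi>: "\<phi> \<in> hom ?F ?F" "continuous_map T T' \<phi>"
    "\<forall>x\<in>topspace X. \<phi> (free_gen x) = free_gen x"
    using T T' unfolding free_topological_group_def by blast
  have gen: "free_gen \<in> topspace X \<rightarrow> carrier ?F"
    by (simp add: free_gen_carrier)
  have "\<phi> w = w" if "w \<in> carrier ?F" for w
    using hom_free_group_unique[OF group_free_group gen \<phi>(1) _ that] \<phi>(3)
      hom_free_group_unique[OF group_free_group gen _ _ that, of id]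
    by (simp add: hom_def)
  moreover have tops: "topspace T = carrier ?F" "topspace T' = carrier ?F"
    using T T' by (auto simp: free_topological_group_def topological_group_def)
  ultimately have "{x \<in> topspace T. \<phi> x \<in> U} = U"
    using openin_subset[OF U] by auto
  then show ?thesis using \<phi>(2) U by (metis openin_continuous_map_preimage)
qed

lemma finest_group_topology_universal:
  fixes H :: "('g, 'b) monoid_scheme"
  assumes top: "topspace T = carrier (free_group (topspace X))"
    and T: "\<And>T' U. topological_group (free_group (topspace X)) T' \<Longrightarrow>
              continuous_map X T' free_gen \<Longrightarrow> openin T' U \<Longrightarrow> openin T U"
    and H: "topological_group H TH" and f: "continuous_map X TH f"
  shows "\<exists>!\<phi>. \<phi> \<in> extensional (carrier (free_group (topspace X))) \<and>
           \<phi> \<in> hom (free_group (topspace X)) H \<and> continuous_map T TH \<phi> \<and>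
           (\<forall>x\<in>topspace X. \<phi> (free_gen x) = f x)"
proof (rule ex_ex1I)
  let ?F = "free_group (topspace X)"
  have grp: "group H" and TH: "topspace TH = carrier H"
    using H by (auto simp: topological_group_def)
  have f': "f \<in> topspace X \<rightarrow> carrier H"
    using f TH by (auto simp: continuous_map_def)
  let ?\<phi> = "free_lift H f"
  have hom: "?\<phi> \<in> hom ?F H" by (rule free_lift_hom[OF grp f'])
  let ?T = "pullback_topology (carrier ?F) ?\<phi> TH"
  have tg: "topological_group ?F ?T"
    by (rule topological_group_pullback[OF group_free_group H hom])
  have "continuous_map X TH (?\<phi> \<circ> free_gen)"
    by (rule continuous_map_eq[OF f]) (simp add: free_lift_gen[OF grp f'])
  then have "continuous_map X ?T free_gen"
    by (rule continuous_map_pullback') (auto simp: free_gen_carrier)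
  then have finer: "openin ?T U \<Longrightarrow> openin T U" for U
    by (rule T[OF tg])
  have "continuous_map T TH ?\<phi>"
    unfolding continuous_map_alt
  proof (intro conjI strip)
    show "openin T (?\<phi> -` U \<inter> topspace T)" if "openin TH U" for U
      using that by (intro finer) (auto simp: openin_pullback_topology top)
    show "?\<phi> \<in> topspace T \<rightarrow> topspace TH"
      using hom by (auto simp: top TH hom_def)
  qed
  then have "continuous_map T TH (restrict ?\<phi> (carrier ?F))"
    by (rule continuous_map_eq) (simp add: top)
  moreover have "restrict ?\<phi> (carrier ?F) \<in> hom ?F H"
    using hom monoid.m_closed[OF group.is_monoid[OF group_free_group]] by (auto simp: hom_def)
  ultimately show "\<exists>\<phi>. \<phi> \<in> extensional (carrier ?F) \<and> \<phi> \<in> hom ?F H \<and> continuous_map T TH \<phi> \<and>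
           (\<forall>x\<in>topspace X. \<phi> (free_gen x) = f x)"
    by (intro exI[of _ "restrict ?\<phi> (carrier ?F)"])
      (simp add: free_lift_gen[OF grp f'] free_gen_carrier)
  fix \<phi> \<psi>
  assume "\<phi> \<in> extensional (carrier ?F) \<and> \<phi> \<in> hom ?F H \<and> continuous_map T TH \<phi> \<and>
           (\<forall>x\<in>topspace X. \<phi> (free_gen x) = f x)"
    and "\<psi> \<in> extensional (carrier ?F) \<and> \<psi> \<in> hom ?F H \<and> continuous_map T TH \<psi> \<and>
           (\<forall>x\<in>topspace X. \<psi> (free_gen x) = f x)"
  then show "\<phi> = \<psi>"
    by (intro extensionalityI[of _ "carrier ?F"]) (auto simp: hom_free_group_unique[OF grp f'])
qed

text \<open>The universal property, for test groups on an arbitrary type.\<close>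

theorem free_topological_group_universal:
  fixes H :: "('g, 'b) monoid_scheme"
  assumes T: "free_topological_group X T"
    and H: "topological_group H TH" and f: "continuous_map X TH f"
  shows "\<exists>!\<phi>. \<phi> \<in> extensional (carrier (free_group (topspace X))) \<and>
           \<phi> \<in> hom (free_group (topspace X)) H \<and> continuous_map T TH \<phi> \<and>
           (\<forall>x\<in>topspace X. \<phi> (free_gen x) = f x)"
proof (rule finest_group_topology_universal[OF _ _ H f])
  show "topspace T = carrier (free_group (topspace X))"
    using T by (auto simp: free_topological_group_def topological_group_def)
qed (rule free_topological_group_finest[OF T])

lemma free_topological_group_unique:
  assumes "free_topological_group X T" "free_topological_group X T'"
  shows "T = T'"
  using assms free_topological_group_finest[of X T T'] free_topological_group_finest[of X T' T]
  by (auto simp: topology_eq free_topological_group_def embedding_map_def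
      dest!: homeomorphic_imp_continuous_map simp: continuous_map_in_subtopology)

text \<open>Existence for completely regular \<open>X\<close>: the join of all group topologies making \<open>free_gen\<close>
  continuous.\<close>

theorem free_topological_group_exists:
  fixes X :: "'a topology"
  assumes X: "completely_regular_space X"
  shows "\<exists>T. free_topological_group X T"
proof -
  let ?F = "free_group (topspace X)"
  define \<T> where "\<T> = {T. topological_group ?F T \<and> continuous_map X T free_gen}"
  define T where "T = topology_generated_by (\<Union>T\<in>\<T>. Collect (openin T))"
  have pullback: "pullback_topology (carrier ?F) (free_lift H f) TH \<in> \<T>"
    if H: "topological_group H TH" and f: "continuous_map X TH f"
    for H :: "('g, 'b) monoid_scheme" and TH f
  proof -
    have grp: "group H" and f': "f \<in> topspace X \<rightarrow> carrier H"
      using H f by (auto simp: topological_group_def continuous_map_def)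
    have "continuous_map X TH (free_lift H f \<circ> free_gen)"
      by (rule continuous_map_eq[OF f]) (simp add: free_lift_gen[OF grp f'])
    then have "continuous_map X (pullback_topology (carrier ?F) (free_lift H f) TH) free_gen"
      by (rule continuous_map_pullback') (auto simp: free_gen_carrier)
    then show ?thesis
      using topological_group_pullback[OF group_free_group H free_lift_hom[OF grp f']]
      by (simp add: \<T>_def)
  qed
  have finer: "openin T U" if "T' \<in> \<T>" "openin T' U" for T' U
    using that unfolding T_def by (intro topology_generated_by_Basis) auto
  have top\<T>: "topspace T' = carrier ?F" if "T' \<in> \<T>" for T'
    using that by (auto simp: \<T>_def topological_group_def)
  define R :: "real monoid" where "R = \<lparr>carrier = UNIV, mult = (+), one = 0\<rparr>"
  have grpR: "group R"
    by (rule groupI) (auto simp: R_def intro: exI[of _ "- _"])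
  have invR: "inv\<^bsub>R\<^esub> x = - x" for x
    by (rule group.inv_equality[OF grpR]) (auto simp: R_def)
  have R: "topological_group R euclideanreal"
    unfolding topological_group_def
    unfolding invR using grpR by (auto simp: R_def case_prod_unfold intro!: continuous_intros)
  obtain T0 where T0: "T0 \<in> \<T>"
    using pullback[OF R, of "\<lambda>_. 0"] by auto
  have topT: "topspace T = carrier ?F"
    unfolding T_def topology_generated_by_topspace
  proof
    show "\<Union>(\<Union>T\<in>\<T>. Collect (openin T)) \<subseteq> carrier ?F"
      using top\<T> openin_subset by fastforce
    show "carrier ?F \<subseteq> \<Union>(\<Union>T\<in>\<T>. Collect (openin T))"
      using T0 top\<T>[OF T0] openin_topspace[of T0] by (metis UN_I Union_upper mem_Collect_eq)
  qed
  have into: "continuous_map Z T g"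
    if "\<And>T'. T' \<in> \<T> \<Longrightarrow> continuous_map Z T' g" for Z :: "'z topology" and g
    unfolding T_def
  proof (rule continuous_on_generated_topo)
    show "openin Z (g -` U \<inter> topspace Z)" if "U \<in> (\<Union>T\<in>\<T>. Collect (openin T))" for U
      using that \<open>\<And>T'. T' \<in> \<T> \<Longrightarrow> continuous_map Z T' g\<close> by (auto simp: continuous_map_alt)
    show "g ` topspace Z \<subseteq> \<Union>(\<Union>T\<in>\<T>. Collect (openin T))"
      using that[OF T0] T0 by (force simp: continuous_map_def)
  qed
  have id: "continuous_map T T' id" if "T' \<in> \<T>" for T'
    unfolding continuous_map_alt
  proof (intro conjI strip)
    fix U assume U: "openin T' U"
    then have "id -` U \<inter> topspace T = U"
      using openin_subset[OF U] top\<T>[OF that] topT by auto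
    then show "openin T (id -` U \<inter> topspace T)" using finer[OF that U] by simp
  qed (use top\<T>[OF that] topT in auto)
  have tg: "topological_group ?F T"
    unfolding topological_group_def
  proof (intro conjI)
    show "continuous_map (prod_topology T T) T (\<lambda>(x, y). x \<otimes>\<^bsub>?F\<^esub> y)"
    proof (rule into)
      fix T' assume T': "T' \<in> \<T>"
      have "continuous_map (prod_topology T T) (prod_topology T' T') (\<lambda>p. (id (fst p), id (snd p)))"
        using continuous_map_compose[OF continuous_map_fst id[OF T'], of T]
          continuous_map_compose[OF continuous_map_snd id[OF T'], of T]
        by (intro continuous_map_pairedI) (simp_all add: o_def)
      from continuous_map_compose[OF this, of T' "\<lambda>(x, y). x \<otimes>\<^bsub>?F\<^esub> y"]
      show "continuous_map (prod_topology T T) T' (\<lambda>(x, y). x \<otimes>\<^bsub>?F\<^esub> y)"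
        using T' by (simp add: \<T>_def topological_group_def o_def)
    qed
    show "continuous_map T T (\<lambda>x. inv\<^bsub>?F\<^esub> x)"
    proof (rule into)
      fix T' assume T': "T' \<in> \<T>"
      from continuous_map_compose[OF id[OF this], of T' "\<lambda>x. inv\<^bsub>?F\<^esub> x"]
      show "continuous_map T T' (\<lambda>x. inv\<^bsub>?F\<^esub> x)"
        using T' by (simp add: \<T>_def topological_group_def o_def)
    qed
  qed (simp_all add: group_free_group topT)
  have genc: "continuous_map X T free_gen"
    by (rule into) (simp add: \<T>_def)
  have emb: "embedding_map X T free_gen"
    unfolding embedding_map_def
  proof (rule bijective_open_imp_homeomorphic_map)
    let ?S = "subtopology T (free_gen ` topspace X)"
    show "continuous_map X ?S free_gen"
      using genc by (simp add: continuous_map_in_subtopology)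
    show "free_gen ` topspace X = topspace ?S"
      using genc by (auto simp: continuous_map_def)
    show "inj_on free_gen (topspace X)"
      by (simp add: inj_on_def free_gen_def)
    show "open_map X ?S free_gen"
      unfolding open_map_def
    proof (intro strip)
      fix U assume U: "openin X U"
      show "openin ?S (free_gen ` U)"
      proof (subst openin_subopen, intro ballI)
        fix w assume "w \<in> free_gen ` U"
        then obtain x where x: "x \<in> U" "w = free_gen x" by blast
        have xX: "x \<in> topspace X" using x U openin_subset by blast
        obtain f where f: "continuous_map X (top_of_set {0..1}) f" "f x = (0::real)"
          "f ` (topspace X - U) \<subseteq> {1}"
        proof -
          have "closedin X (topspace X - U) \<and> x \<in> topspace X - (topspace X - U)"
            using U x xX by blast
          then show ?thesis using that X unfolding completely_regular_space_def by metis
        qed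
        have fc: "continuous_map X euclideanreal f"
          using f(1) continuous_map_in_subtopology by blast
        have f': "f \<in> topspace X \<rightarrow> carrier R" by (simp add: R_def)
        let ?\<phi> = "free_lift R f"
        define V where "V = ?\<phi> -` {..<1} \<inter> carrier ?F"
        have "openin T V"
          unfolding V_def by (rule finer[OF pullback[OF R fc]]) (auto simp: openin_pullback_topology intro!: exI[of _ "{..<1}"])
        then have op: "openin ?S (V \<inter> free_gen ` topspace X)"
          by (simp add: openin_subtopology_Int)
        have gen: "?\<phi> (free_gen y) = f y" if "y \<in> topspace X" for y
          by (rule free_lift_gen[OF grpR f' that])
        have "w \<in> V \<inter> free_gen ` topspace X"
          using x xX gen f(2) by (auto simp: V_def free_gen_carrier)
        moreover have "V \<inter> free_gen ` topspace X \<subseteq> free_gen ` U"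
        proof
          fix v assume "v \<in> V \<inter> free_gen ` topspace X"
          then obtain y where y: "v = free_gen y" "y \<in> topspace X" "f y < 1"
            using gen by (auto simp: V_def)
          then have "y \<in> U" using f(3) by force
          then show "v \<in> free_gen ` U" using y by blast
        qed
        ultimately show "\<exists>W. openin ?S W \<and> w \<in> W \<and> W \<subseteq> free_gen ` U"
          using op by blast
      qed
    qed
  qed
  have "\<exists>!\<phi>. \<phi> \<in> extensional (carrier ?F) \<and> \<phi> \<in> hom ?F H \<and> continuous_map T TH \<phi> \<and>
           (\<forall>x\<in>topspace X. \<phi> (free_gen x) = f x)"
    if H: "topological_group H TH" and f: "continuous_map X TH f"
    for H :: "'a word monoid" and TH f
    using finest_group_topology_universal[OF topT _ that] finer by (auto simp: \<T>_def)
  with tg emb have "free_topological_group X T"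
    unfolding free_topological_group_def by blast
  then show ?thesis ..
qed

lemma completely_regular_space_hedgehog: "completely_regular_space (hedgehog K)"
  unfolding completely_regular_space_def
proof (intro allI impI, elim conjE)
  fix S x assume S: "closedin (hedgehog K) S" and x: "x \<in> topspace (hedgehog K) - S"
  have "openin (hedgehog K) (hedgehog_points K - S)" using S by (simp add: closedin_def)
  then obtain V where V: "openin (hedgehog K) V" "openin (hedgehog K) (hedgehog_points K - V)"
    "x \<in> V" "V \<inter> S = {}"
  proof (cases x)
    case Center
    then obtain m where m: "m \<ge> 1"
      "insert Center {Spine \<alpha> n |\<alpha> n. \<alpha> \<in> K \<and> m \<le> n} \<subseteq> hedgehog_points K - S"
      using x \<open>openin (hedgehog K) (hedgehog_points K - S)\<close> by (auto simp: openin_hedgehog)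
    show ?thesis
      by (rule that[of "insert Center {Spine \<alpha> n |\<alpha> n. \<alpha> \<in> K \<and> m \<le> n}"])
        (use m Center in \<open>auto simp: openin_hedgehog\<close>)
  next
    case (Spine \<alpha> n)
    show ?thesis
      by (rule that[of "{x}"])
        (use x Spine in \<open>auto simp: openin_hedgehog hedgehog_points_def intro!: exI[of _ "Suc n"]\<close>)
  qed
  let ?f = "\<lambda>y. if y \<in> V then 0 else (1::real)"
  have "continuous_map (hedgehog K) (top_of_set {0..1}) ?f"
    unfolding continuous_map_alt
  proof (intro conjI strip)
    fix U :: "real set"
    have "?f -` U \<inter> topspace (hedgehog K) =
      (if 0 \<in> U then V else {}) \<union> (if 1 \<in> U then hedgehog_points K - V else {})"
      using openin_subset[OF V(1)] by (auto split: if_splits)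
    then show "openin (hedgehog K) (?f -` U \<inter> topspace (hedgehog K))"
      using V by (simp add: openin_Un)
  qed auto
  moreover have "?f x = 0" "?f ` S \<subseteq> {1}" using V by auto
  ultimately show "\<exists>f. continuous_map (hedgehog K) (top_of_set {0..1}) f \<and> f x = (0::real) \<and> f ` S \<subseteq> {1}"
    by blast
qed

corollary free_topological_group_hedgehog_exists: "\<exists>T. free_topological_group (hedgehog K) T"
  by (rule free_topological_group_exists[OF completely_regular_space_hedgehog])

end

theory Submission
  imports Defs
begin

text \<open>Let \<open>r\<^sub>m\<close> send all points of level at least \<open>m\<close> to the center, and let \<open>y\<close> be in the closure of
  \<open>A\<close>. If some word \<open>v\<close>, not necessarily reduced but with value \<open>y\<close>, is for unboundedly many \<open>m\<close> the
  letterwise image under \<open>r\<^sub>m\<close> of a word in \<open>A\<close>, then these words converge to \<open>y\<close>.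

  Otherwise \<open>v\<close> recurs only up to some level, for every \<open>v\<close>. For large \<open>m\<close> this excludes all of the finitely
  many \<open>v\<close> whose letters occur in \<open>y\<close> or are central. A reduced \<open>w\<close> of length at most 4 such that
  \<open>r\<^sub>m w\<close> has value \<open>y\<close> and is not of this kind must cancel inside out: \<open>y\<close> is the identity and \<open>w\<close> is a
  conjugate of \<open>b b'\<^sup>-\<^sup>1\<close> or \<open>b\<^sup>-\<^sup>1 b'\<close> by a letter \<open>a\<^sup>\<plusminus>\<close> below level \<open>m\<close>, with \<open>b\<close>, \<open>b'\<close> high. The
  heights that \<open>b\<close> and \<open>b'\<close> can both reach are bounded in terms of \<open>a\<close>, so such \<open>w\<close> are kept away from the
  identity by the stabilizer of a point in a suitable action of the free group by permutations;
  stabilizers are open for the topology of pointwise convergence.\<close>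

section \<open>Homomorphisms to discrete groups and permutation groups\<close>

text \<open>The universal property only provides some continuous homomorphism; uniqueness identifies
  it with the explicit formula on the carrier.\<close>

lemma continuous_map_free_lift:
  fixes H :: "('g, 'b) monoid_scheme"
  assumes T: "free_topological_group X T"
    and H: "topological_group H TH" and f: "continuous_map X TH f"
  shows "continuous_map T TH (free_lift H f)"
proof -
  let ?F = "free_group (topspace X)"
  obtain \<phi> where \<phi>: "\<phi> \<in> hom ?F H" "continuous_map T TH \<phi>"
    "\<forall>x\<in>topspace X. \<phi> (free_gen x) = f x"
    using free_topological_group_universal[OF assms] by blast
  have grp: "group H" and f': "f \<in> topspace X \<rightarrow> carrier H"
    using H f by (auto simp: topological_group_def continuous_map_def)
  have "topspace T = carrier ?F"
    using T by (simp add: free_topological_group_def topological_group_def)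
  then show ?thesis
    by (intro continuous_map_eq[OF \<phi>(2)])
      (use hom_free_group_unique[OF grp f' \<phi>(1)] \<phi>(3) in auto)
qed

lemma continuous_map_into_discrete:
  assumes "f \<in> topspace X \<rightarrow> S" "\<And>y. openin X {x \<in> topspace X. f x = y}"
  shows "continuous_map X (discrete_topology S) f"
  unfolding continuous_map_alt
proof (intro conjI strip)
  fix U
  have "f -` U \<inter> topspace X = (\<Union>y\<in>U. {x \<in> topspace X. f x = y})"
    by auto
  then show "openin X (f -` U \<inter> topspace X)"
    using assms(2) by auto
qed (use assms(1) in simp)

lemma topological_group_discrete:
  assumes "group G"
  shows "topological_group G (discrete_topology (carrier G))"
proof -
  interpret group G by (rule assms)
  show ?thesis
    unfolding topological_group_def
    by (auto simp: assms simp flip: prod_topology_discrete_topology)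
qed

definition reduce :: "'a word \<Rightarrow> 'a word" where
  "reduce w = foldr cancel_Cons w []"

lemma reduce_Cons [simp]: "reduce (a # w) = cancel_Cons a (reduce w)"
  and reduce_Nil [simp]: "reduce [] = []"
  by (simp_all add: reduce_def)

lemma reduce_reduced: "reduced_word w \<Longrightarrow> reduce w = w"
  by (simp add: reduce_def foldr_cancel_Cons_Nil)

text \<open>Exhibits \<open>reduce (collapse_word m w)\<close> as the value of a homomorphism at
  \<open>w\<close>; with a discrete target group its fibres are open.\<close>

lemma free_lift_free_group:
  assumes "f \<in> topspace X \<rightarrow> S" "fst ` set w \<subseteq> topspace X"
  shows "free_lift (free_group S) (\<lambda>x. free_gen (f x)) w = reduce (map (map_prod f id) w)"
  using assms(2)
proof (induction w)
  case Nil
  show ?case by (simp add: free_lift_def one_free_group)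
next
  case (Cons a w)
  have "f (fst a) \<in> S"
    using assms(1) Cons.prems by auto
  then show ?case
    using Cons by (cases a)
      (auto simp: free_lift_def mult_free_group inv_free_gen, simp_all add: free_gen_def)
qed

definition perm_group :: "('w \<Rightarrow> 'w) monoid" where
  "perm_group = \<lparr>carrier = {f. bij f}, mult = (\<circ>), one = id\<rparr>"

definition pointwise_topology :: "('w \<Rightarrow> 'w) topology" where
  "pointwise_topology =
     subtopology (product_topology (\<lambda>_. discrete_topology UNIV) UNIV) {f. bij f}"

lemma group_perm_group: "group perm_group"
  by (rule groupI) (auto simp: perm_group_def bij_comp comp_assoc intro: exI[of _ "inv_into UNIV _"] bij_imp_bij_inv inv_o_cancel bij_is_inj)

lemma inv_perm_group:
  assumes "bij f"
  shows "inv\<^bsub>perm_group\<^esub> f = inv_into UNIV f"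
  by (rule group.inv_equality[OF group_perm_group])
    (use assms in \<open>auto simp: perm_group_def bij_imp_bij_inv bij_is_inj\<close>)

lemma topspace_pointwise [simp]: "topspace pointwise_topology = {f. bij f}"
  by (simp add: pointwise_topology_def)

lemma openin_pointwise: "openin pointwise_topology {f. bij f \<and> f \<omega> = \<eta>}"
proof -
  have "continuous_map pointwise_topology (discrete_topology UNIV) (\<lambda>f. f \<omega>)"
    unfolding pointwise_topology_def
    by (intro continuous_map_from_subtopology continuous_map_product_projection) simp
  from openin_continuous_map_preimage[OF this, of "{\<eta>}"] show ?thesis
    by simp
qed

lemma continuous_map_pointwiseI:
  assumes "\<And>x. x \<in> topspace X \<Longrightarrow> bij (f x)"
    and "\<And>\<omega> \<eta>. openin X {x \<in> topspace X. f x \<omega> = \<eta>}"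
  shows "continuous_map X pointwise_topology f"
  unfolding pointwise_topology_def continuous_map_in_subtopology continuous_map_componentwise_UNIV
  using assms by (auto intro!: continuous_map_into_discrete)

lemma topological_group_perm_group: "topological_group perm_group pointwise_topology"
  unfolding topological_group_def
proof (intro conjI)
  let ?P = "pointwise_topology :: ('a \<Rightarrow> 'a) topology"
  show "continuous_map (prod_topology ?P ?P) ?P (\<lambda>(f, g). f \<otimes>\<^bsub>perm_group\<^esub> g)"
  proof (rule continuous_map_pointwiseI)
    fix \<omega> \<eta> :: 'a
    \<comment> \<open>Split according to the intermediate value \<xi> of \<open>g\<close> at
      \<omega>: each piece is an open box.\<close>
    have "{x \<in> topspace (prod_topology ?P ?P). (case x of (f, g) \<Rightarrow> f \<otimes>\<^bsub>perm_group\<^esub> g) \<omega> = \<eta>}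
      = (\<Union>\<xi>. {f. bij f \<and> f \<xi> = \<eta>} \<times> {g. bij g \<and> g \<omega> = \<xi>})"
      by (auto simp: perm_group_def)
    then show "openin (prod_topology ?P ?P) {x \<in> topspace (prod_topology ?P ?P).
        (case x of (f, g) \<Rightarrow> f \<otimes>\<^bsub>perm_group\<^esub> g) \<omega> = \<eta>}"
      by (auto simp: openin_prod_Times_iff openin_pointwise intro!: openin_Union)
  qed (auto simp: perm_group_def bij_comp)
  show "continuous_map ?P ?P (\<lambda>f. inv\<^bsub>perm_group\<^esub> f)"
  proof (rule continuous_map_pointwiseI)
    fix \<omega> \<eta> :: 'a
    have "{f \<in> topspace ?P. (inv\<^bsub>perm_group\<^esub> f) \<omega> = \<eta>} = {f. bij f \<and> f \<eta> = \<omega>}"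
      by (auto simp: inv_perm_group bij_is_surj surj_f_inv_f bij_is_inj)
    then show "openin ?P {f \<in> topspace ?P. (inv\<^bsub>perm_group\<^esub> f) \<omega> = \<eta>}"
      by (simp add: openin_pointwise)
  qed (simp add: inv_perm_group bij_imp_bij_inv)
qed (simp_all add: group_perm_group, simp add: perm_group_def)

section \<open>Collapsing the high levels of the hedgehog\<close>

definition collapse :: "nat \<Rightarrow> 'k hedgehog_point \<Rightarrow> 'k hedgehog_point" where
  "collapse m x = (case x of Center \<Rightarrow> Center | Spine \<alpha> n \<Rightarrow> if n < m then x else Center)"

abbreviation collapse_word :: "nat \<Rightarrow> 'k hedgehog_point word \<Rightarrow> 'k hedgehog_point word" where
  "collapse_word m \<equiv> map (map_prod (collapse m) id)"

lemma collapse_cases: "collapse m x = Center \<or> collapse m x = x"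
  by (cases x) (auto simp: collapse_def)

lemma collapse_Center [simp]: "collapse m Center = Center"
  by (simp add: collapse_def)

lemma collapse_mono: "collapse m x = x \<Longrightarrow> m \<le> m' \<Longrightarrow> collapse m' x = x"
  by (cases x) (auto simp: collapse_def split: if_splits)

lemma collapse_max:
  "collapse m x = Center \<Longrightarrow> collapse m' x = Center \<Longrightarrow> collapse (max m m') x = Center"
  by (cases x) (auto simp: collapse_def split: if_splits)

lemma eventually_collapse: "\<exists>m. collapse m x = x"
  by (cases x) (auto simp: collapse_def)

lemma collapse_in: "x \<in> hedgehog_points K \<Longrightarrow> collapse m x \<in> hedgehog_points K"
  using collapse_cases[of m x] by (auto simp: hedgehog_points_def)

lemma openin_hedgehogI:
  assumes "U \<subseteq> hedgehog_points K"
    and "Center \<in> U \<Longrightarrow> \<exists>m. \<forall>x\<in>hedgehog_points K. collapse m x = Center \<longrightarrow> x \<in> U"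
  shows "openin (hedgehog K) U"
  unfolding openin_hedgehog
proof (intro conjI impI)
  assume C: "Center \<in> U"
  then obtain m where m: "\<forall>x\<in>hedgehog_points K. collapse m x = Center \<longrightarrow> x \<in> U"
    using assms(2) by blast
  then show "\<exists>m\<ge>1. insert Center {Spine \<alpha> n |\<alpha> n. \<alpha> \<in> K \<and> m \<le> n} \<subseteq> U"
    using C by (intro exI[of _ "Suc m"]) (auto simp: hedgehog_points_def collapse_def)
qed (rule assms(1))

lemma openin_hedgehog_collapse:
  assumes "openin (hedgehog K) U" "Center \<in> U"
  shows "\<exists>m. \<forall>x\<in>hedgehog_points K. \<forall>m'\<ge>m. collapse m' x = Center \<longrightarrow> x \<in> U"
proof -
  obtain m where m: "insert Center {Spine \<alpha> n |\<alpha> n. \<alpha> \<in> K \<and> m \<le> n} \<subseteq> U"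
    using assms unfolding openin_hedgehog by blast
  have "x \<in> U" if x: "x \<in> hedgehog_points K" "m \<le> m'" "collapse m' x = Center" for x m'
  proof (cases x)
    case (Spine \<alpha> n)
    then have "\<alpha> \<in> K" "m \<le> n"
      using x by (auto simp: hedgehog_points_def collapse_def split: if_splits)
    then show ?thesis using m Spine by blast
  qed (use assms(2) in simp)
  then show ?thesis by blast
qed

text \<open>If \<open>z\<close> is the center, then \<open>x k\<close> is central or has level at
  least \<open>m k\<close>, hence at least \<open>k\<close>; otherwise collapsing fixed
  \<open>x k\<close> and the sequence is constant.\<close>

lemma limitin_hedgehog:
  assumes "\<And>k::nat. x k \<in> hedgehog_points K" "\<And>k. collapse (m k) (x k) = z" "\<And>k. k \<le> m k"
  shows "limitin (hedgehog K) x z sequentially"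
  unfolding limitin_sequentially
proof (intro conjI strip)
  show "z \<in> topspace (hedgehog K)"
    using assms(1,2) collapse_in by fastforce
  fix U assume U: "openin (hedgehog K) U \<and> z \<in> U"
  show "\<exists>N. \<forall>n\<ge>N. x n \<in> U"
  proof (cases "z = Center")
    case True
    then obtain N where N: "\<forall>x\<in>hedgehog_points K. \<forall>m'\<ge>N. collapse m' x = Center \<longrightarrow> x \<in> U"
      using U openin_hedgehog_collapse by blast
    have "x k \<in> U" if "N \<le> k" for k
      using N assms(1,2)[of k] True order_trans[OF that assms(3)[of k]] by simp
    then show ?thesis by blast
  next
    case False
    then have "x k = z" for k
      using assms(2) collapse_cases[of "m k" "x k"] by auto
    then show ?thesis using U by simp
  qed
qed

text \<open>The letters converge position by position, and multiplication and inversion are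
  continuous. Only the shape of \<open>v\<close> is common to all \<open>w k\<close>, so the
  induction peels off first letters.\<close>

lemma limitin_reduce:
  assumes T: "free_topological_group (hedgehog K) T"
    and w: "\<And>k. fst ` set (w k) \<subseteq> hedgehog_points K"
      "\<And>k::nat. collapse_word (m k) (w k) = v" "\<And>k. k \<le> m k"
  shows "limitin T (\<lambda>k. reduce (w k)) (reduce v) sequentially"
  using w(1,2)
proof (induction v arbitrary: w)
  let ?F = "free_group (hedgehog_points K)"
  have tops: "topspace T = carrier ?F"
    and mult: "continuous_map (prod_topology T T) T (\<lambda>(x, y). x \<otimes>\<^bsub>?F\<^esub> y)"
    and inv: "continuous_map T T (\<lambda>x. inv\<^bsub>?F\<^esub> x)"
    and gen: "continuous_map (hedgehog K) T free_gen"
    using T by (auto simp: free_topological_group_def topological_group_def embedding_map_def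
        continuous_map_in_subtopology dest!: homeomorphic_imp_continuous_map)
  {
    case Nil
    then show ?case
      by (simp add: tops carrier_free_group)
  next
    case (Cons a v)
    obtain z s where a: "a = (z, s)" by (cases a)
    define x where "x k = fst (hd (w k))" for k
    define u where "u k = tl (w k)" for k
    have wk: "w k = (x k, s) # u k" and z: "collapse (m k) (x k) = z"
      and u: "collapse_word (m k) (u k) = v" for k
      using Cons.prems(2)[of k] a by (auto simp: x_def u_def)
    have x: "x k \<in> hedgehog_points K" and u': "fst ` set (u k) \<subseteq> hedgehog_points K" for k
      using Cons.prems(1)[of k] wk[of k] by auto
    have zK: "z \<in> hedgehog_points K"
      using collapse_in[OF x[of 0]] z by metis
    have "limitin (hedgehog K) x z sequentially"
      by (rule limitin_hedgehog[OF x z w(3)])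
    then have lg: "limitin T (\<lambda>k. free_gen (x k)) (free_gen z) sequentially"
      using continuous_map_limit[OF gen] by (simp add: o_def)
    have "limitin T (\<lambda>k. inv\<^bsub>?F\<^esub> (free_gen (x k))) (inv\<^bsub>?F\<^esub> (free_gen z)) sequentially"
      using continuous_map_limit[OF inv lg] by (simp add: o_def)
    with lg have la: "limitin T (\<lambda>k. [(x k, s)]) [a] sequentially"
      using x zK by (cases s) (auto simp: a inv_free_gen, simp_all add: free_gen_def)
    have "limitin (prod_topology T T) (\<lambda>k. ([(x k, s)], reduce (u k))) ([a], reduce v) sequentially"
      using la Cons.IH[OF u' u] by (simp add: limitin_pairwise o_def)
    from continuous_map_limit[OF mult this]
    show ?case by (simp add: o_def mult_free_group wk)
  }
qed

section \<open>Words that collapse to a given word\<close>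

text \<open>A letter outside \<open>C\<close> cannot cancel against a neighbour. If it disappears,
  it and its partner enclose a cancelling pair, and length 4 leaves room for one such pattern
  only.\<close>

lemma reduce_short:
  assumes "length v \<le> 4" "successively (\<lambda>p q. q = inv_letter p \<longrightarrow> fst p \<in> C) v"
  shows "set v \<subseteq> set (reduce v) \<union> C \<times> UNIV \<or>
    (\<exists>p q. v = [p, q, inv_letter q, inv_letter p] \<and> fst p \<notin> C \<and> fst q \<in> C)"
proof -
  consider "v = []" | p where "v = [p]" | p q where "v = [p, q]" | p q t where "v = [p, q, t]"
    | p q t u where "v = [p, q, t, u]"
    using assms(1) by (auto simp: numeral_eq_Suc le_Suc_eq length_Suc_conv)
  then show ?thesis
  proof cases
    case (4 p q t)
    then show ?thesis
      using assms(2) by (cases "t = inv_letter q"; cases "q = inv_letter p")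
        (simp_all add: cancel_Cons_def mem_Times_iff)
  next
    case (5 p q t u)
    consider "t = inv_letter q" | "t \<noteq> inv_letter q" "u = inv_letter t"
      | "t \<noteq> inv_letter q" "u \<noteq> inv_letter t"
      by blast
    then show ?thesis
    proof cases
      case 1
      then have "reduce v = cancel_Cons p [u]"
        using 5 cancel_Cons_inv[of "[u]" q] by (simp add: cancel_Cons_reduced)
      then show ?thesis
        using assms(2) 1 5 by (cases "u = inv_letter p") (simp_all add: cancel_Cons_def mem_Times_iff)
    next
      case 2
      then show ?thesis
        using assms(2) 5 by (cases "q = inv_letter p") (simp_all add: cancel_Cons_def mem_Times_iff)
    next
      case 3
      then show ?thesis
        using assms(2) 5 by (cases "q = inv_letter p") (simp_all add: cancel_Cons_def mem_Times_iff)
    qed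
  qed (use assms(2) in \<open>simp_all add: cancel_Cons_def mem_Times_iff\<close>)
qed

lemma collapse_word_short:
  assumes "reduced_word w" "length w \<le> 4"
  shows "set (collapse_word m w) \<subseteq> set (reduce (collapse_word m w)) \<union> {Center} \<times> UNIV \<or>
    (\<exists>a s b b' e. w = [(a, s), (b, e), (b', \<not> e), (a, \<not> s)] \<and> b \<noteq> b' \<and>
       reduce (collapse_word m w) = [] \<and> collapse m a \<noteq> Center \<and>
       collapse m b = Center \<and> collapse m b' = Center)"
proof -
  let ?v = "collapse_word m w"
  \<comment> \<open>A collapsed point other than the center is unchanged, so a cancellation not
    already present in \<open>w\<close> involves central letters.\<close>
  have cancel: "fst (map_prod (collapse m) id p) = Center"
    if "q \<noteq> inv_letter p" "map_prod (collapse m) id q = inv_letter (map_prod (collapse m) id p)"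
    for p q
    using that collapse_cases[of m "fst p"] collapse_cases[of m "fst q"]
    by (cases p; cases q) auto
  have "successively (\<lambda>p q. q = inv_letter p \<longrightarrow> fst p \<in> {Center}) ?v"
    unfolding successively_map
    by (rule successively_mono[OF assms(1)[unfolded reduced_word_def]]) (use cancel in auto)
  then consider "set ?v \<subseteq> set (reduce ?v) \<union> {Center} \<times> UNIV"
    | p q where "?v = [p, q, inv_letter q, inv_letter p]" "fst p \<noteq> Center" "fst q = Center"
    using reduce_short[of ?v "{Center}"] assms(2) by auto
  then show ?thesis
  proof cases
    case (2 p q)
    then obtain a s b e b' e' a' s' where w: "w = [(a, s), (b, e), (b', e'), (a', s')]"
      by (auto simp: map_eq_Cons_conv)
    with 2 have "e' = (\<not> e)" "s' = (\<not> s)" "collapse m b = Center" "collapse m b' = Center"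
      "collapse m a \<noteq> Center" "collapse m a' = collapse m a"
      by auto
    moreover have "reduce ?v = []"
      using 2(1) by (simp add: cancel_Cons_def)
    moreover from calculation have "a' = a"
      using collapse_cases[of m a] collapse_cases[of m a'] by simp
    ultimately show ?thesis
      using w assms(1) by auto
  qed simp
qed

section \<open>A permutation action\<close>

text \<open>A low point \<open>a\<close> swaps \<open>[]\<close> with \<open>[a]\<close>; a high point \<open>x\<close> swaps \<open>[a]\<close> with \<open>[x, a]\<close> for every
  low \<open>a\<close> such that \<open>x\<close> lies below the level \<open>\<mu> a\<close>. Hence \<open>a\<^sup>\<plusminus> b\<^sup>\<plusminus> b'\<^sup>\<mp> a\<^sup>\<mp>\<close> fixes \<open>[]\<close> only
  when \<open>b\<close> and \<open>b'\<close> are at least as high as \<open>\<mu> a\<close>.\<close>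

definition moves :: "nat \<Rightarrow> ('k hedgehog_point \<Rightarrow> nat) \<Rightarrow> 'k hedgehog_point \<Rightarrow>
    'k hedgehog_point \<Rightarrow> bool" where
  "moves m \<mu> x a \<longleftrightarrow> collapse m a \<noteq> Center \<and> collapse m x = Center \<and> collapse (\<mu> a) x \<noteq> Center"

fun swap :: "nat \<Rightarrow> ('k hedgehog_point \<Rightarrow> nat) \<Rightarrow> 'k hedgehog_point \<Rightarrow>
    'k hedgehog_point list \<Rightarrow> 'k hedgehog_point list" where
  "swap m \<mu> x [] = (if collapse m x \<noteq> Center then [x] else [])"
| "swap m \<mu> x [a] =
     (if collapse m x \<noteq> Center \<and> a = x then [] else if moves m \<mu> x a then [x, a] else [a])"
| "swap m \<mu> x [b, a] = (if b = x \<and> moves m \<mu> x a then [a] else [b, a])"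
| "swap m \<mu> x (c # b # a # u) = c # b # a # u"

lemma swap_swap: "swap m \<mu> x (swap m \<mu> x u) = u"
  by (cases "(m, \<mu>, x, u)" rule: swap.cases) (auto simp: moves_def)

lemma bij_swap: "bij (swap m \<mu> x)"
  by (rule o_bij[of "swap m \<mu> x"]) (auto simp: swap_swap)

lemma inv_swap: "inv_into UNIV (swap m \<mu> x) = swap m \<mu> x"
  by (rule inv_unique_comp) (auto simp: swap_swap)

text \<open>This gives continuity at the center. The bound \<mu> in \<open>moves\<close> is there
  for it: without it, arbitrarily high points would move \<open>[a]\<close>.\<close>

lemma swap_high:
  fixes u :: "'a hedgehog_point list"
  shows "\<exists>k. \<forall>x. collapse k x = Center \<longrightarrow> swap m \<mu> x u = u"
proof -
  have le: "collapse i x = Center" if "i \<le> j" "collapse j x = Center" for i j x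
    using that by (cases x) (auto simp: collapse_def split: if_splits)
  consider "u = []" | a where "u = [a]" | b a where "u = [b, a]" | c b a t where "u = c # b # a # t"
    by (cases "(m, \<mu>, Center :: 'a hedgehog_point, u)" rule: swap.cases) auto
  then show ?thesis
  proof cases
    case 1
    then show ?thesis by (intro exI[of _ m]) simp
  next
    case 2
    have "swap m \<mu> x u = u" if "collapse (max m (\<mu> a)) x = Center" for x
      using 2 le[OF _ that, of m] le[OF _ that, of "\<mu> a"] by (auto simp: moves_def)
    then show ?thesis by blast
  next
    case 3
    obtain k where "collapse k b = b" using eventually_collapse by blast
    then show ?thesis using 3 by (intro exI[of _ k]) (auto simp: moves_def)
  qed auto
qed

lemma continuous_map_swap: "continuous_map (hedgehog K) pointwise_topology (swap m \<mu>)"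
proof (rule continuous_map_pointwiseI)
  fix u v
  obtain k where k: "\<forall>x. collapse k x = Center \<longrightarrow> swap m \<mu> x u = u"
    using swap_high by blast
  show "openin (hedgehog K) {x \<in> topspace (hedgehog K). swap m \<mu> x u = v}"
    by (rule openin_hedgehogI) (use k in \<open>auto intro!: exI[of _ k]\<close>)
qed (rule bij_swap)

text \<open>Swaps are involutions, so the exponents do not matter.\<close>

lemma free_lift_swap:
  "free_lift perm_group (swap m \<mu>) w = foldr (\<lambda>a f. swap m \<mu> (fst a) \<circ> f) w id"
  unfolding free_lift_def
  by (simp add: inv_perm_group bij_swap inv_swap cong: if_cong) (simp add: perm_group_def)

text \<open>The last letter acts first and sends \<open>[]\<close> to \<open>[a]\<close>. If
  \<open>b'\<close> or else \<open>b\<close> then adds itself on top, the remaining letters cannot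
  remove it, and \<open>[]\<close> is not reached again.\<close>

lemma swap_conjugate:
  assumes "collapse m a \<noteq> Center" "collapse m b = Center" "collapse m b' = Center" "b \<noteq> b'"
    and "free_lift perm_group (swap m \<mu>) [(a, s), (b, e), (b', e'), (a, s')] [] = []"
  shows "collapse (\<mu> a) b = Center \<and> collapse (\<mu> a) b' = Center"
  using assms by (auto simp: free_lift_swap moves_def split: if_splits)

section \<open>Closure points\<close>

lemma collapse_word_recurs:
  fixes T :: "'k hedgehog_point word topology"
  assumes T: "free_topological_group (hedgehog K) T"
    and A: "A \<subseteq> free_group_le (hedgehog_points K) 4"
    and y: "y \<in> free_group_le (hedgehog_points K) 4" "y \<in> T closure_of A"
  shows "\<exists>v. reduce v = y \<and> (\<forall>n. \<exists>m\<ge>n. \<exists>w\<in>A. collapse_word m w = v)"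
proof (rule ccontr)
  let ?F = "free_group (hedgehog_points K)"
  assume "\<not> ?thesis"
  then have "\<forall>v. \<exists>n. reduce v = y \<longrightarrow> (\<forall>m\<ge>n. \<forall>w\<in>A. collapse_word m w \<noteq> v)"
    by blast
  then obtain M where M: "\<And>v m w. reduce v = y \<Longrightarrow> M v \<le> m \<Longrightarrow> w \<in> A \<Longrightarrow> collapse_word m w \<noteq> v"
    by metis
  have tops: "topspace T = carrier ?F"
    using T by (simp add: free_topological_group_def topological_group_def)
  have Aw: "reduced_word w" "length w \<le> 4" "fst ` set w \<subseteq> hedgehog_points K"
    if "w \<in> insert y A" for w
    using that A y by (auto simp: free_group_le_def carrier_free_group)
  define S where "S = {v :: 'k hedgehog_point word. set v \<subseteq> set y \<union> {Center} \<times> UNIV \<and> length v \<le> 4}"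
  have "finite S"
    unfolding S_def by (intro finite_lists_length_le) auto
  obtain l where l: "\<And>x :: 'k hedgehog_point. collapse (l x) x = x"
    using eventually_collapse by metis
  \<comment> \<open>High enough to exclude every word of the finite set \<open>S\<close> with value
    \<open>y\<close> and to leave the letters of \<open>y\<close> fixed.\<close>
  define m where "m = Max (insert 0 (M ` S \<union> (l \<circ> fst) ` set y))"
  have mS: "M v \<le> m" if "v \<in> S" for v
    unfolding m_def using that \<open>finite S\<close> by (intro Max_ge) auto
  have my: "collapse m x = x" if "x \<in> fst ` set y" for x
    by (rule collapse_mono[OF l])
      (unfold m_def, use that \<open>finite S\<close> in \<open>intro Max_ge, auto simp: image_comp\<close>)
  \<comment> \<open>The maximum is over the four sign patterns of a conjugate of a trivial central
    pair by \<open>a\<close>.\<close>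
  define \<mu> where "\<mu> a = Max ((\<lambda>(s, e). M [(a, s), (Center, e), (Center, \<not> e), (a, \<not> s)]) ` UNIV)" for a
  have \<mu>: "M [(a, s), (Center, e), (Center, \<not> e), (a, \<not> s)] \<le> \<mu> a" for a s e
    unfolding \<mu>_def by (intro Max_ge) (auto intro!: image_eqI[of _ _ "(s, e)"])
  define U where "U = {w \<in> topspace T. reduce (collapse_word m w) = y}"
  define V where "V = {w \<in> topspace T. free_lift perm_group (swap m \<mu>) w [] = []}"
  have "continuous_map (hedgehog K) (discrete_topology (carrier ?F)) (\<lambda>x. free_gen (collapse m x))"
  proof (rule continuous_map_into_discrete)
    show "openin (hedgehog K) {x \<in> topspace (hedgehog K). free_gen (collapse m x) = u}" for u
      by (rule openin_hedgehogI) (auto intro!: exI[of _ m])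
  qed (auto simp: free_gen_carrier collapse_in)
  from continuous_map_free_lift[OF T topological_group_discrete[OF group_free_group] this]
  have "openin T {w \<in> topspace T.
      free_lift ?F (\<lambda>x. free_gen (collapse m x)) w \<in> {y}}"
    by (rule openin_continuous_map_preimage) (use y in \<open>simp add: free_group_le_def\<close>)
  also have "\<dots> = U"
    using free_lift_free_group[of "collapse m" "hedgehog K" "hedgehog_points K"]
    by (auto simp: U_def tops carrier_free_group collapse_in)
  finally have "openin T U" .
  moreover have "openin T V"
  proof -
    have c: "continuous_map T pointwise_topology (free_lift perm_group (swap m \<mu>))"
      by (rule continuous_map_free_lift[OF T topological_group_perm_group continuous_map_swap])
    have "openin T {w \<in> topspace T.
        free_lift perm_group (swap m \<mu>) w \<in> {f. bij f \<and> f [] = []}}"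
      by (rule openin_continuous_map_preimage[OF c openin_pointwise])
    also have "\<dots> = V"
      using continuous_map_image_subset_topspace[OF c] by (auto simp: V_def)
    finally show ?thesis .
  qed
  moreover have "y \<in> U"
  proof -
    have "collapse_word m y = y"
      by (rule map_idI) (use my in force)
    then show ?thesis
      using y by (simp add: U_def tops free_group_le_def reduce_reduced carrier_free_group)
  qed
  \<comment> \<open>\<open>V\<close> contains the identity but perhaps not another \<open>y\<close>,
    hence the case distinction.\<close>
  ultimately obtain w where w: "w \<in> A" "w \<in> U" "y = [] \<Longrightarrow> w \<in> V"
  proof (cases "y = []")
    case True
    then have "y \<in> U \<inter> V"
      using \<open>y \<in> U\<close> by (simp add: U_def V_def free_lift_swap)
    moreover have "openin T (U \<inter> V)"
      using \<open>openin T U\<close> \<open>openin T V\<close> by blast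
    ultimately show ?thesis
      using y(2) that unfolding in_closure_of by blast
  next
    case False
    then show ?thesis
      using y(2) that \<open>openin T U\<close> \<open>y \<in> U\<close> unfolding in_closure_of by blast
  qed
  have red: "reduce (collapse_word m w) = y"
    using w(2) by (simp add: U_def)
  have "collapse_word m w \<notin> S"
    using M[OF red mS w(1)] by blast
  then have "\<not> set (collapse_word m w) \<subseteq> set (reduce (collapse_word m w)) \<union> {Center} \<times> UNIV"
    using Aw(2)[of w] w(1) by (simp add: S_def red)
  then obtain a s b b' e where *: "w = [(a, s), (b, e), (b', \<not> e), (a, \<not> s)]" "b \<noteq> b'" "y = []"
    "collapse m a \<noteq> Center" "collapse m b = Center" "collapse m b' = Center"
    using collapse_word_short[of w m] Aw(1,2)[of w] w(1) red by auto
  \<comment> \<open>At level \<open>m\<close> the bound \<open>M\<close> for this conjugate need not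
    be reached yet. Since \<open>b\<close> and \<open>b'\<close> still collapse at level \<mu>
    \<open>a\<close>, the same collapsed word recurs at \<open>m'\<close>, where \<open>M\<close>
    forbids it.\<close>
  define m' where "m' = max m (\<mu> a)"
  have "free_lift perm_group (swap m \<mu>) [(a, s), (b, e), (b', \<not> e), (a, \<not> s)] [] = []"
    using w(3) * by (simp add: V_def)
  then have "collapse (\<mu> a) b = Center \<and> collapse (\<mu> a) b' = Center"
    by (rule swap_conjugate[OF *(4-6,2)])
  then have "collapse m' b = Center" "collapse m' b' = Center"
    using collapse_max * by (auto simp: m'_def)
  moreover have "collapse m' a = a"
    using collapse_cases[of m a] collapse_mono[of m a m'] * by (auto simp: m'_def)
  ultimately have "collapse_word m' w = [(a, s), (Center, e), (Center, \<not> e), (a, \<not> s)]"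
    using *(1) by simp
  moreover have "M [(a, s), (Center, e), (Center, \<not> e), (a, \<not> s)] \<le> m'"
    using \<mu> by (simp add: m'_def max.coboundedI2)
  ultimately show False
    using M[of "[(a, s), (Center, e), (Center, \<not> e), (a, \<not> s)]" m' w] w(1) *(3)
    by (simp add: cancel_Cons_def)
qed

theorem corollary3p5:
  fixes K :: "'k set" and T :: "'k hedgehog_point word topology"
  assumes "free_topological_group (hedgehog K) T"
  shows "frechet_urysohn_space (subtopology T (free_group_le (topspace (hedgehog K)) 4))"
  unfolding frechet_urysohn_space_def topspace_hedgehog
proof (intro allI impI, elim conjE)
  let ?F4 = "free_group_le (hedgehog_points K) 4"
  fix A y
  assume A: "A \<subseteq> topspace (subtopology T ?F4)" and y: "y \<in> subtopology T ?F4 closure_of A"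
  have A': "A \<subseteq> ?F4" and y': "y \<in> ?F4" "y \<in> T closure_of A"
    using A y by (auto simp: closure_of_subtopology) (meson closure_of_mono inf_le2 subsetD)
  obtain v where v: "reduce v = y" "\<And>n. \<exists>m\<ge>n. \<exists>w\<in>A. collapse_word m w = v"
    using collapse_word_recurs[OF assms A' y'] by blast
  then obtain m w where w: "\<And>n. n \<le> m n" "\<And>n. w n \<in> A" "\<And>n. collapse_word (m n) (w n) = v"
    by metis
  have w': "reduced_word (w n)" "fst ` set (w n) \<subseteq> hedgehog_points K" for n
    using w(2)[of n] A' by (auto simp: free_group_le_def carrier_free_group)
  have "limitin T w y sequentially"
    using limitin_reduce[OF assms w'(2) w(3,1)] v(1) by (simp add: reduce_reduced w'(1))
  then have "limitin (subtopology T ?F4) w y sequentially"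
    using w(2) A' y'(1) by (simp add: limitin_subtopology subset_iff)
  then show "\<exists>s. range s \<subseteq> A \<and> limitin (subtopology T ?F4) s y sequentially"
    using w(2) by blast
qed

end
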